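(* Let $0<\alpha<1$ and let $(\epsilon_i)_{i\ge 1}$ be a nonincreasing sequence of positive real numbers with $\epsilon_1\le 1-\alpha$ and $\sum_{i=1}^{+\infty}2^{i-1}\epsilon_i<\alpha$. Let $\psi:[0,1)\to\mathbb{R}$ be the pointwise limit $\psi(x)=\lim_{i\to\infty}\psi_i(x)$ of the sequence of functions $\psi_i$ constructed from $\alpha,\epsilon_1,\epsilon_2,\ldots$ as described in the context. Then $\psi$ is a facet for the infinite group problem with $f=\alpha$.
   Context: Infinite group problem: for given $f\in(0,1)$, a solution is a vector $s=(s_r)_{r\in[0,1)}$ of nonnegative integers with finite support (only finitely many $s_r\ne 0$) such that $\sum_{r\in[0,1)} r s_r = f$, where additions are performed modulo 1. A function $\pi:[0,1)\to\mathbb{R}$ is a valid function if $\pi$ is nonnegative, $\pi(0)=0$, and every solution $s$ satisfies $\sum_{r\in[0,1)}\pi(r)s_r\ge 1$. (Valid functions are not required to be continuous.) For a valid function $\pi$, let $P(\pi)$ be the set of solutions $s$ with $\sum_{r}\pi(r)s_r=1$. A valid function $\pi$ is a facet if for every valid function $\pi^*$, $P(\pi^* )\supseteq P(\pi)$ implies $\pi^*=\pi$. Construction of $\psi_i$: let $0<\alpha<1$ and let $(\epsilon_i)_{i\ge1}$ be a nonincreasing sequence of positive reals with $\epsilon_1\le 1-\alpha$ and $\sum_{i\ge1}2^{i-1}\epsilon_i<\alpha$. Define $\psi_0(x)=x/\alpha$ for $0\le x\le\alpha$ and $\psi_0(x)=(1-x)/(1-\alpha)$ for $\alpha\le x<1$.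 Given $\psi_i$, the function $\psi_{i+1}:[0,1)\to\mathbb{R}$ is obtained by modifying $\psi_i$ as follows: for every maximal (with respect to inclusion) interval $[a,b]\subseteq[0,\alpha]$ on which $\psi_i$ has constant positive slope, the line segment of the graph from $(a,\psi_i(a))$ to $(b,\psi_i(b))$ is replaced by the three segments successively connecting the points $(a,\psi_i(a))$, $\left(\frac{a+b-\epsilon_{i+1}}{2},\psi_i(\frac{a+b}{2})+\frac{\epsilon_{i+1}}{2(1-\alpha)}\right)$, $\left(\frac{a+b+\epsilon_{i+1}}{2},\psi_i(\frac{a+b}{2})-\frac{\epsilon_{i+1}}{2(1-\alpha)}\right)$, $(b,\psi_i(b))$; elsewhere $\psi_{i+1}=\psi_i$. The pointwise limit $\psi(x)=\lim_{i\to\infty}\psi_i(x)$ exists for every $x\in[0,1)$. *)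

theory Defs
  imports Complex_Main
begin

section \<open>The infinite group problem\<close>

text \<open>Functions on \<open>[0,1)\<close> are represented by total functions on the reals whose values
  outside \<open>{0..<1}\<close> are never inspected; in particular two of them are identified when they
  agree on \<open>{0..<1}\<close>.\<close>

definition is_solution :: "real \<Rightarrow> (real \<Rightarrow> nat) \<Rightarrow> bool" where
  "is_solution f s \<longleftrightarrow>
     finite {r. s r \<noteq> 0} \<and> {r. s r \<noteq> 0} \<subseteq> {0..<1} \<and>
     frac (\<Sum>r | s r \<noteq> 0. r * real (s r)) = f"

definition weight :: "(real \<Rightarrow> real) \<Rightarrow> (real \<Rightarrow> nat) \<Rightarrow> real" where
  "weight \<pi> s = (\<Sum>r | s r \<noteq> 0. \<pi> r * real (s r))"

definition valid_function :: "real \<Rightarrow> (real \<Rightarrow> real) \<Rightarrow> bool" where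
  "valid_function f \<pi> \<longleftrightarrow>
     (\<forall>r\<in>{0..<1}. 0 \<le> \<pi> r) \<and> \<pi> 0 = 0 \<and> (\<forall>s. is_solution f s \<longrightarrow> 1 \<le> weight \<pi> s)"

definition tight_solutions :: "real \<Rightarrow> (real \<Rightarrow> real) \<Rightarrow> (real \<Rightarrow> nat) set" where
  "tight_solutions f \<pi> = {s. is_solution f s \<and> weight \<pi> s = 1}"

definition is_facet :: "real \<Rightarrow> (real \<Rightarrow> real) \<Rightarrow> bool" where
  "is_facet f \<pi> \<longleftrightarrow> valid_function f \<pi> \<and>
     (\<forall>\<pi>'. valid_function f \<pi>' \<and> tight_solutions f \<pi> \<subseteq> tight_solutions f \<pi>' \<longrightarrow>
        (\<forall>r\<in>{0..<1}. \<pi>' r = \<pi> r))"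


section \<open>The construction\<close>

definition const_pos_slope :: "(real \<Rightarrow> real) \<Rightarrow> real \<Rightarrow> real \<Rightarrow> bool" where
  "const_pos_slope g a b \<longleftrightarrow>
     a < b \<and> (\<exists>m>0. \<forall>x\<in>{a..b}. \<forall>y\<in>{a..b}. g y - g x = m * (y - x))"

definition max_pos_interval :: "real \<Rightarrow> (real \<Rightarrow> real) \<Rightarrow> real \<Rightarrow> real \<Rightarrow> bool" where
  "max_pos_interval \<alpha> g a b \<longleftrightarrow>
     {a..b} \<subseteq> {0..\<alpha>} \<and> const_pos_slope g a b \<and>
     (\<forall>a' b'. {a'..b'} \<subseteq> {0..\<alpha>} \<and> const_pos_slope g a' b' \<and> {a..b} \<subseteq> {a'..b'} \<longrightarrow>
        {a'..b'} = {a..b})"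

definition line_through :: "real \<times> real \<Rightarrow> real \<times> real \<Rightarrow> real \<Rightarrow> real" where
  "line_through p q x = snd p + (snd q - snd p) / (fst q - fst p) * (x - fst p)"

definition three_segments :: "real \<Rightarrow> real \<Rightarrow> (real \<Rightarrow> real) \<Rightarrow> real \<Rightarrow> real \<Rightarrow> real \<Rightarrow> real" where
  "three_segments \<alpha> e g a b x =
     (let p = (a, g a);
          q = ((a + b - e) / 2, g ((a + b) / 2) + e / (2 * (1 - \<alpha>)));
          r = ((a + b + e) / 2, g ((a + b) / 2) - e / (2 * (1 - \<alpha>)));
          t = (b, g b)
      in if x \<le> fst q then line_through p q x
         else if x \<le> fst r then line_through q r x
         else line_through r t x)"

text \<open>The choice is harmless: two distinct maximal intervals share at most an endpoint (if they
  overlapped more, the slope would be constant on their union), and when \<open>0 < e < b - a\<close>,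
  \<open>three_segments\<close> agrees with \<open>g\<close> at the endpoints.\<close>

definition psi_step :: "real \<Rightarrow> real \<Rightarrow> (real \<Rightarrow> real) \<Rightarrow> real \<Rightarrow> real" where
  "psi_step \<alpha> e g x =
     (if \<exists>a b. max_pos_interval \<alpha> g a b \<and> x \<in> {a..b}
      then (case (SOME (a, b). max_pos_interval \<alpha> g a b \<and> x \<in> {a..b}) of
              (a, b) \<Rightarrow> three_segments \<alpha> e g a b x)
      else g x)"

text \<open>The sequence \<open>\<epsilon>\<close> is indexed from 1; the value \<open>\<epsilon> 0\<close> is not used.\<close>

primrec psi_seq :: "real \<Rightarrow> (nat \<Rightarrow> real) \<Rightarrow> nat \<Rightarrow> real \<Rightarrow> real" where
  "psi_seq \<alpha> \<epsilon> 0 = (\<lambda>x. if x \<le> \<alpha> then x / \<alpha> else (1 - x) / (1 - \<alpha>))"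
| "psi_seq \<alpha> \<epsilon> (Suc i) = psi_step \<alpha> (\<epsilon> (Suc i)) (psi_seq \<alpha> \<epsilon> i)"

definition psi_limit :: "real \<Rightarrow> (nat \<Rightarrow> real) \<Rightarrow> real \<Rightarrow> real" where
  "psi_limit \<alpha> \<epsilon> x = lim (\<lambda>i. psi_seq \<alpha> \<epsilon> i x)"

end

theory Submission
  imports Defs
begin

text \<open>
  Adding \<open>x / (1 - \<alpha>)\<close> to the periodic extension of \<open>\<psi>\<close> and rescaling by \<open>1 - \<alpha>\<close> gives a
  nondecreasing function \<open>\<Phi>\<close> with \<open>\<Phi> (x + 1) = \<Phi> x + 1\<close>, constant on the intervals of negative
  slope: the distribution function of a fat Cantor set. At stage \<open>n\<close> that set consists of blocks
  of equal length, and the gaps between them form a sequence in which the gap before block \<open>k\<close>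
  depends monotonically on the exponent of 2 in \<open>k\<close>. Hence the left endpoints of the blocks are
  superadditive in \<open>k\<close>, so \<open>\<Phi>\<close> is subadditive, and \<open>\<psi>\<close> is valid.

  Let \<open>\<pi>\<close> be valid and tight wherever \<open>\<psi>\<close> is. Symmetry of \<open>\<psi>\<close> makes \<open>\<pi>\<close> symmetric, hence
  subadditive, and additive wherever \<open>\<psi>\<close> is. The same transformation turns \<open>\<pi>\<close> into a function
  \<open>g\<close> that is additive and bounded on \<open>[\<alpha> - 1, 0]\<close> and vanishes at both ends of it, so it vanishes
  there. By subadditivity \<open>g\<close> is nondecreasing, and by additivity it is constant across gaps and
  grows by the same amount over every block. So \<open>g\<close> and \<open>\<Phi>\<close> agree at all block endpoints, and
  by monotonicity everywhere.
\<close>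

text \<open>Each replacement segment can thus be identified by naming an affine function with the
  right values at its two ends.\<close>

lemma line_through_affine:
  assumes "u \<noteq> v" and affine: "\<And>x. F x = m * x + c"
  shows "line_through (u, F u) (v, F v) x = F x"
proof -
  have "F v - F u = m * (v - u)"
    by (simp add: affine algebra_simps)
  then have "line_through (u, F u) (v, F v) x = F u + m * (x - u)"
    using assms(1) by (simp add: line_through_def)
  then show ?thesis by (simp add: affine algebra_simps)
qed

section \<open>Solutions and subadditivity\<close>

lemma subadditive_sum_le:
  fixes p :: "real \<Rightarrow> real"
  assumes subadd: "\<And>x y. p (x + y) \<le> p x + p y" and "p 0 = 0" and "finite A"
  shows "p (\<Sum>r\<in>A. r * real (n r)) \<le> (\<Sum>r\<in>A. p r * real (n r))"
  using \<open>finite A\<close>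
proof induction
  case (insert a A)
  have "p (a * real m) \<le> p a * real m" for m
  proof (induction m)
    case (Suc m)
    then show ?case using subadd[of a "a * real m"] by (simp add: algebra_simps)
  qed (simp add: \<open>p 0 = 0\<close>)
  with insert show ?case
    using subadd[of "a * real (n a)" "\<Sum>r\<in>A. r * real (n r)"] by (simp add: add_mono order_trans)
qed (simp add: \<open>p 0 = 0\<close>)

text \<open>The sum over a solution is congruent to \<open>f\<close> modulo 1, so periodicity
  reduces the claim to iterated subadditivity. Validity then rests on the value at \<open>f\<close>
  alone.\<close>

lemma subadditive_le_weight:
  assumes "\<And>x y. p (x + y) \<le> p x + p y" "p 0 = 0" and frac: "\<And>x. p (frac x) = p x"
    and sol: "is_solution f s"
  shows "p f \<le> weight p s"
proof -
  have "p f = p (\<Sum>r | s r \<noteq> 0. r * real (s r))"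
    using sol frac unfolding is_solution_def by metis
  also have "\<dots> \<le> weight p s"
    using sol unfolding weight_def is_solution_def by (intro subadditive_sum_le assms) simp
  finally show ?thesis .
qed

text \<open>Summing indicators counts coinciding entries with multiplicity.\<close>

definition triple :: "real \<Rightarrow> real \<Rightarrow> real \<Rightarrow> real \<Rightarrow> nat" where
  "triple a b c r = of_bool (r = a) + of_bool (r = b) + of_bool (r = c)"

lemma triple_support: "{r. triple a b c r \<noteq> 0} = {a, b, c}"
  by (auto simp: triple_def)

lemma sum_triple: "(\<Sum>r | triple a b c r \<noteq> 0. h r * real (triple a b c r)) = h a + h b + h c"
proof -
  have delta: "(\<Sum>r\<in>{a, b, c}. h r * of_bool (r = d)) = h d" if "d \<in> {a, b, c}" for d
  proof -
    have "(\<Sum>r\<in>{a, b, c}. h r * of_bool (r = d)) = (\<Sum>r\<in>{a, b, c}. if r = d then h r else 0)"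
      by (intro sum.cong) auto
    also have "\<dots> = h d"
      using that by (subst sum.delta) auto
    finally show ?thesis .
  qed
  have "(\<Sum>r\<in>{a, b, c}. h r * real (triple a b c r)) =
      (\<Sum>r\<in>{a, b, c}. h r * of_bool (r = a)) + (\<Sum>r\<in>{a, b, c}. h r * of_bool (r = b))
      + (\<Sum>r\<in>{a, b, c}. h r * of_bool (r = c))"
    unfolding sum.distrib[symmetric] by (intro sum.cong) (auto simp: triple_def algebra_simps)
  then show ?thesis
    by (simp only: delta triple_support insert_iff simp_thms)
qed

lemma weight_triple: "weight h (triple a b c) = h a + h b + h c"
  unfolding weight_def by (rule sum_triple)

text \<open>The third entry makes up the remainder modulo 1. The facet argument tests competing
  functions on such solutions only.\<close>

lemma triple_solution:
  assumes "0 \<le> f" "f < 1"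
  shows "is_solution f (triple (frac u) (frac v) (frac (f - u - v)))"
proof -
  have "frac (frac u + frac v + frac (f - u - v)) = f"
    unfolding frac_unique_iff using assms by (simp add: frac_def)
  then show ?thesis
    unfolding is_solution_def sum_triple[where h = "\<lambda>r. r"]
    unfolding triple_support by (auto simp: frac_lt_1)
qed

section \<open>The blocks of positive slope\<close>

locale construction =
  fixes \<alpha> :: real and \<epsilon> :: "nat \<Rightarrow> real"
  assumes alpha_pos: "0 < \<alpha>" and alpha_less_1: "\<alpha> < 1"
    and eps_pos: "\<And>i. 1 \<le> i \<Longrightarrow> 0 < \<epsilon> i"
    and eps_antimono: "\<And>i j. 1 \<le> i \<Longrightarrow> i \<le> j \<Longrightarrow> \<epsilon> j \<le> \<epsilon> i"
    and eps_1: "\<epsilon> 1 \<le> 1 - \<alpha>"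
    and eps_summable: "summable (\<lambda>i. 2 ^ i * \<epsilon> (Suc i))"
    and eps_suminf: "(\<Sum>i. 2 ^ i * \<epsilon> (Suc i)) < \<alpha>"
begin

text \<open>At stage \<open>n\<close> the intervals of positive slope are \<open>[left n k, left n k + len n]\<close> for
  \<open>0 \<le> k < 2 ^ n\<close>, continued 1-periodically to all integers \<open>k\<close>; \<open>idx n x\<close> is the largest \<open>k\<close>
  with \<open>left n k \<le> x\<close>.\<close>

primrec len :: "nat \<Rightarrow> real" where
  "len 0 = \<alpha>"
| "len (Suc n) = (len n - \<epsilon> (Suc n)) / 2"

primrec left :: "nat \<Rightarrow> int \<Rightarrow> real" where
  "left 0 = (\<lambda>k. of_int k)"
| "left (Suc n) = (\<lambda>k. left n (k div 2) + (if odd k then len (Suc n) + \<epsilon> (Suc n) else 0))"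

primrec idx :: "nat \<Rightarrow> real \<Rightarrow> int" where
  "idx 0 = floor"
| "idx (Suc n) = (\<lambda>x. 2 * idx n x +
     (if left n (idx n x) + len (Suc n) + \<epsilon> (Suc n) \<le> x then 1 else 0))"

text \<open>A lower bound for all gaps of stage \<open>n\<close>: the newest ones have length
  \<open>\<epsilon> n\<close>, and stage 0 has only the gaps between the periodic copies of
  \<open>[0, \<alpha>]\<close>.\<close>

definition min_gap :: "nat \<Rightarrow> real" where
  "min_gap n = (if n = 0 then 1 - \<alpha> else \<epsilon> n)"

lemma min_gap_pos: "0 < min_gap n"
  using alpha_less_1 eps_pos by (simp add: min_gap_def)

text \<open>New gaps never exceed older ones; this is how the monotonicity of
  \<open>\<epsilon>\<close> and the bound on \<open>\<epsilon> 1\<close> enter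
  superadditivity.\<close>

lemma min_gap_Suc: "\<epsilon> (Suc n) \<le> min_gap n"
  using eps_1 eps_antimono[of n "Suc n"] by (simp add: min_gap_def)

lemma eps_le: "\<epsilon> (Suc n) \<le> 1 - \<alpha>"
  using eps_1 eps_antimono[of 1 "Suc n"] by simp

text \<open>The left side is the total block length in one period; passing from stage
  \<open>i\<close> to \<open>i + 1\<close> removes \<open>2 ^ i\<close> middle intervals of length
  \<open>\<epsilon> (Suc i)\<close>.\<close>

lemma len_eq: "2 ^ n * len n = \<alpha> - (\<Sum>i<n. 2 ^ i * \<epsilon> (Suc i))"
proof (induction n)
  case (Suc n)
  have "2 ^ Suc n * len (Suc n) = 2 ^ n * len n - 2 ^ n * \<epsilon> (Suc n)"
    by (simp add: right_diff_distrib)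
  then show ?case using Suc by simp
qed simp

lemma len_pos: "0 < len n"
proof -
  have "(\<Sum>i<n. 2 ^ i * \<epsilon> (Suc i)) \<le> (\<Sum>i. 2 ^ i * \<epsilon> (Suc i))"
    by (rule sum_le_suminf[OF eps_summable]) (simp_all add: less_imp_le eps_pos)
  then have "0 < 2 ^ n * len n"
    unfolding len_eq using eps_suminf by simp
  then show ?thesis by (simp add: zero_less_mult_iff)
qed

lemma len_scaled_le: "2 ^ n * len n \<le> \<alpha>"
  unfolding len_eq by (simp add: sum_nonneg less_imp_le eps_pos)

lemma len_Suc_double: "len n = 2 * len (Suc n) + \<epsilon> (Suc n)"
  by (simp add: field_simps)

lemma left_even: "left (Suc n) (2 * k) = left n k"
  by simp

lemma left_odd: "left (Suc n) (2 * k + 1) = left n k + len (Suc n) + \<epsilon> (Suc n)"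
  by simp

declare left.simps(2) [simp del] len.simps(2) [simp del]

text \<open>The gap after an even block is newly cut and has length
  \<open>\<epsilon> (Suc n)\<close>; the gap after an odd block is inherited from stage
  \<open>n\<close>.\<close>

lemma left_step_ge: "left n k + len n + min_gap n \<le> left n (k + 1)"
proof (induction n arbitrary: k)
  case 0
  show ?case by (simp add: min_gap_def)
next
  case (Suc n)
  show ?case
  proof (cases "even k")
    case True
    then obtain j where k: "k = 2 * j" by blast
    show ?thesis
      unfolding k by (simp only: left_even left_odd) (simp add: min_gap_def)
  next
    case False
    then obtain j where k: "k = 2 * j + 1" by (blast elim: oddE)
    have "left (Suc n) (k + 1) = left n (j + 1)"
      using left_even[of n "j + 1"] by (simp add: k algebra_simps)
    then show ?thesis
      using Suc.IH[of j] min_gap_Suc[of n] len_Suc_double[of n] left_odd[of n j]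
      by (simp add: k min_gap_def)
  qed
qed

text \<open>Ensures later that every gap can be crossed by a single shift of length at most
  \<open>1 - \<alpha>\<close>.\<close>

lemma left_step_le: "left n (k + 1) \<le> left n k + len n + (1 - \<alpha>)"
proof (induction n arbitrary: k)
  case 0
  show ?case by simp
next
  case (Suc n)
  show ?case
  proof (cases "even k")
    case True
    then obtain j where k: "k = 2 * j" by blast
    show ?thesis
      using eps_le[of n] unfolding k by (simp only: left_even left_odd)
  next
    case False
    then obtain j where k: "k = 2 * j + 1" by (blast elim: oddE)
    have "left (Suc n) (k + 1) = left n (j + 1)"
      using left_even[of n "j + 1"] by (simp add: k algebra_simps)
    then show ?thesis
      using Suc.IH[of j] len_Suc_double[of n] left_odd[of n j]
      by (simp add: k)
  qed
qed

section \<open>Order, superadditivity, period and symmetry of the left endpoints\<close>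

lemma left_Suc_less: "left n k + len n < left n (k + 1)"
  using left_step_ge[of n k] min_gap_pos[of n] by linarith

lemma left_less: "j < k \<Longrightarrow> left n j < left n k"
proof (induction k rule: int_gr_induct)
  case base
  show ?case using left_Suc_less[of n j] len_pos[of n] by linarith
next
  case (step i)
  then show ?case using left_Suc_less[of n i] len_pos[of n] by linarith
qed

lemma left_mono: "j \<le> k \<Longrightarrow> left n j \<le> left n k"
  using left_less[of j k n] by (cases "j = k") auto

text \<open>Induction on the binary digits of the indices. Without a carry, both sides gain the same
  shift over stage \<open>n\<close>; the carry from two odd indices is where gap sizes
  matter.\<close>

lemma left_superadd: "left n j + left n k \<le> left n (j + k)"
proof (induction n arbitrary: j k)
  case 0
  show ?case by simp
next
  case (Suc n)
  obtain a b where ab: "j = 2 * a + of_bool (odd j)" "k = 2 * b + of_bool (odd k)"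
    by (metis mod2_eq_if mult_div_mod_eq of_bool_def)
  consider "even j" "even k" | "odd j" "even k" | "even j" "odd k" | "odd j" "odd k" by blast
  then show ?case
  proof cases
    case 1
    then have "j = 2 * a" "k = 2 * b" using ab by auto
    then show ?thesis
      using Suc.IH[of a b] left_even[of n "a + b"] by (simp add: left_even)
  next
    case 2
    then have "j = 2 * a + 1" "k = 2 * b" using ab by auto
    then show ?thesis
      using Suc.IH[of a b] left_odd[of n "a + b"] left_odd[of n a] left_even[of n b]
      by (simp add: algebra_simps)
  next
    case 3
    then have "j = 2 * a" "k = 2 * b + 1" using ab by auto
    then show ?thesis
      using Suc.IH[of a b] left_odd[of n "a + b"] left_odd[of n b] left_even[of n a]
      by (simp add: algebra_simps)
  next
    case 4
    then have "j = 2 * a + 1" "k = 2 * b + 1" using ab by auto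
    \<comment> \<open>Two half steps add up to \<open>len n + \<epsilon> (Suc n)\<close>, which is
      at most a whole step from \<open>b\<close> to \<open>b + 1\<close> at stage
      \<open>n\<close>.\<close>
    then show ?thesis
      using Suc.IH[of a "b + 1"] left_even[of n "a + b + 1"] left_odd[of n a] left_odd[of n b]
        left_step_ge[of n b] min_gap_Suc[of n] len_Suc_double[of n]
      by (simp add: algebra_simps)
  qed
qed

lemma left_0 [simp]: "left n 0 = 0"
  by (induction n) (simp_all add: left.simps(2))

lemma left_period: "left n (k + 2 ^ n) = left n k + 1"
proof (induction n arbitrary: k)
  case 0
  show ?case by simp
next
  case (Suc n)
  have "(k + 2 ^ Suc n) div 2 = k div 2 + 2 ^ n"
    by simp
  then show ?case
    using Suc.IH[of "k div 2"] by (simp only: left.simps(2)) simp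
qed

text \<open>The map sending \<open>x\<close> to \<open>\<alpha> - x\<close> permutes the blocks: it
  swaps the two halves of every split and turns right endpoints into left ones.\<close>

lemma left_reflect: "left n (2 ^ n - 1 - k) = \<alpha> - len n - left n k"
proof (induction n arbitrary: k)
  case 0
  show ?case by simp
next
  case (Suc n)
  show ?case
  proof (cases "even k")
    case True
    then obtain j where k: "k = 2 * j" by blast
    have "2 ^ Suc n - 1 - k = 2 * (2 ^ n - 1 - j) + 1"
      by (simp add: k)
    then show ?thesis
      using Suc.IH[of j] len_Suc_double[of n]
      by (simp only: left_odd) (simp add: k left_even)
  next
    case False
    then obtain j where k: "k = 2 * j + 1" by (blast elim: oddE)
    have "2 ^ Suc n - 1 - k = 2 * (2 ^ n - 1 - j)"
      by (simp add: k)
    then show ?thesis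
      using Suc.IH[of j] len_Suc_double[of n] left_odd[of n j]
      by (simp only: left_even) (simp add: k)
  qed
qed

section \<open>Counting block starts\<close>

lemma idx_bounds: "left n (idx n x) \<le> x \<and> x < left n (idx n x + 1)"
proof (induction n)
  case 0
  show ?case by simp
next
  case (Suc n)
  show ?case
    using Suc left_odd[of n "idx n x"] left_even[of n "idx n x"] left_even[of n "idx n x + 1"]
    by (simp add: algebra_simps)
qed

lemma idx_unique:
  assumes "left n k \<le> x" "x < left n (k + 1)"
  shows "idx n x = k"
proof (rule ccontr)
  assume "idx n x \<noteq> k"
  then consider "idx n x + 1 \<le> k" | "k + 1 \<le> idx n x" by linarith
  then show False
    using idx_bounds[of n x] left_mono[of "idx n x + 1" k n] left_mono[of "k + 1" "idx n x" n] assms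
    by cases linarith+
qed

lemma idx_left: "idx n (left n k) = k"
  by (rule idx_unique) (simp_all add: left_less)

lemma idx_mono: "x \<le> y \<Longrightarrow> idx n x \<le> idx n y"
proof (rule ccontr)
  assume "x \<le> y" and "\<not> idx n x \<le> idx n y"
  then show False
    using left_mono[of "idx n y + 1" "idx n x" n] idx_bounds[of n x] idx_bounds[of n y] by linarith
qed

lemma idx_less_iff: "idx n x < k \<longleftrightarrow> x < left n k"
proof
  assume "idx n x < k"
  then show "x < left n k"
    using idx_bounds[of n x] left_mono[of "idx n x + 1" k n] by linarith
next
  assume *: "x < left n k"
  show "idx n x < k"
  proof (rule ccontr)
    assume "\<not> idx n x < k"
    then show False
      using idx_bounds[of n x] left_mono[of k "idx n x" n] * by linarith
  qed
qed

text \<open>Superadditivity of \<open>left n\<close> passes to its inverse \<open>idx n\<close> as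
  subadditivity, with an error of 1 from rounding.\<close>

lemma idx_add_le: "idx n (x + y) \<le> idx n x + idx n y + 1"
proof -
  have "x + y < left n ((idx n x + 1) + (idx n y + 1))"
    using idx_bounds[of n x] idx_bounds[of n y] left_superadd[of n "idx n x + 1" "idx n y + 1"]
    by linarith
  then show ?thesis
    by (simp flip: idx_less_iff)
qed

lemma idx_period: "idx n (x + 1) = idx n x + 2 ^ n"
  using idx_bounds[of n x] left_period[of n "idx n x"] left_period[of n "idx n x + 1"]
  by (intro idx_unique) (simp_all add: algebra_simps)

section \<open>The limit function\<close>

text \<open>Every block start counts \<open>1 / 2 ^ n\<close>. With counts instead of interpolated
  stages, the rounding errors in the inequalities for \<open>idx n\<close> vanish in the
  limit.\<close>

definition Phi :: "real \<Rightarrow> real" where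
  "Phi x = lim (\<lambda>n. idx n x / 2 ^ n)"

lemma idx_scaled_tendsto: "(\<lambda>n. idx n x / 2 ^ n) \<longlonglongrightarrow> Phi x"
proof -
  have inc: "incseq (\<lambda>n. idx n x / 2 ^ n)"
    by (rule incseq_SucI) (simp add: field_simps)
  \<comment> \<open>The added 1 makes the bound inductive, as \<open>idx (Suc n) x + 1\<close> is at
    most \<open>2 * (idx n x + 1)\<close>.\<close>
  have "idx n x + 1 \<le> 2 ^ n * (\<lfloor>x\<rfloor> + 1)" for n
    by (induction n) auto
  then have "real_of_int (idx n x + 1) \<le> real_of_int (2 ^ n * (\<lfloor>x\<rfloor> + 1))" for n
    by (simp only: of_int_le_iff)
  then have "idx n x / 2 ^ n \<le> \<lfloor>x\<rfloor> + 1" for n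
    by (simp add: field_simps) (smt (verit, best))
  then have "convergent (\<lambda>n. idx n x / 2 ^ n)"
    using incseq_convergent[OF inc] by (metis convergentI)
  then show ?thesis
    unfolding Phi_def by (simp add: convergent_LIMSEQ_iff)
qed

lemma const_scaled_tendsto_0: "(\<lambda>n. (c::real) / 2 ^ n) \<longlonglongrightarrow> 0"
  using tendsto_mult_right[OF LIMSEQ_inverse_realpow_zero[of 2], of c]
  by (simp add: field_simps)

lemma Phi_mono: "x \<le> y \<Longrightarrow> Phi x \<le> Phi y"
  by (rule LIMSEQ_le[OF idx_scaled_tendsto idx_scaled_tendsto])
    (auto intro!: divide_right_mono simp: idx_mono)

text \<open>A left endpoint remains one at all later stages and its index doubles each time, so the
  sequence is constant from stage \<open>n\<close> on.\<close>

lemma Phi_left: "Phi (left n k) = k / 2 ^ n"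
proof -
  have "idx (n + m) (left n k) = 2 ^ m * k" for m
  proof (induction m)
    case 0
    show ?case by (simp add: idx_left)
  next
    case (Suc m)
    have "left (n + m) (2 ^ m * k) = left n k" for m
      by (induction m) (simp_all add: left_even mult.assoc)
    with Suc show ?case
      using len_pos[of "Suc (n + m)"] eps_pos[of "Suc (n + m)"] by simp
  qed
  then have "(\<lambda>m. idx (m + n) (left n k) / 2 ^ (m + n)) \<longlonglongrightarrow> k / 2 ^ n"
    by (simp add: add.commute power_add)
  then have "(\<lambda>m. idx m (left n k) / 2 ^ m) \<longlonglongrightarrow> k / 2 ^ n"
    by (rule LIMSEQ_offset)
  then show ?thesis
    using idx_scaled_tendsto LIMSEQ_unique by blast
qed

lemma Phi_0 [simp]: "Phi 0 = 0"
  using Phi_left[of 0 0] by simp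

lemma Phi_plus_1: "Phi (x + 1) = Phi x + 1"
proof -
  have "(\<lambda>n. idx n (x + 1) / 2 ^ n) \<longlonglongrightarrow> Phi x + 1"
    using tendsto_add[OF idx_scaled_tendsto[of x] tendsto_const[of 1]]
    by (simp add: idx_period add_divide_distrib)
  then show ?thesis
    using idx_scaled_tendsto LIMSEQ_unique by blast
qed

lemma Phi_subadd: "Phi (x + y) \<le> Phi x + Phi y"
proof -
  have "(\<lambda>n. idx n x / 2 ^ n + idx n y / 2 ^ n + 1 / 2 ^ n) \<longlonglongrightarrow> Phi x + Phi y + 0"
    by (intro tendsto_add idx_scaled_tendsto const_scaled_tendsto_0)
  moreover have "idx n (x + y) / 2 ^ n \<le> idx n x / 2 ^ n + idx n y / 2 ^ n + 1 / 2 ^ n" for n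
  proof -
    have "real_of_int (idx n (x + y)) \<le> real_of_int (idx n x + idx n y + 1)"
      using idx_add_le by (simp only: of_int_le_iff)
    then show ?thesis
      by (simp add: divide_right_mono flip: add_divide_distrib)
  qed
  ultimately show ?thesis
    using LIMSEQ_le[OF idx_scaled_tendsto] by auto
qed

text \<open>By \<open>left_reflect\<close> the index of \<open>\<alpha> - x\<close> is
  \<open>2 ^ n - idx n x\<close> up to an error of at most 2, which disappears after
  scaling.\<close>

lemma Phi_reflect: "Phi (\<alpha> - x) = 1 - Phi x"
proof -
  have bd: "1 - (idx n x + 2) / 2 ^ n \<le> idx n (\<alpha> - x) / 2 ^ n"
    "idx n (\<alpha> - x) / 2 ^ n \<le> 1 - idx n x / 2 ^ n" for n
  proof -
    let ?k = "idx n x"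
    have "left n (2 ^ n - 2 - ?k) = \<alpha> - len n - left n (?k + 1)"
      using left_reflect[of n "?k + 1"] by (simp add: algebra_simps)
    then have "\<not> \<alpha> - x < left n (2 ^ n - 2 - ?k)"
      using idx_bounds[of n x] len_pos[of n] by linarith
    then have 1: "2 ^ n - 2 - ?k \<le> idx n (\<alpha> - x)"
      by (simp flip: idx_less_iff)
    have "\<alpha> - x < left n (2 ^ n - 1 - ?k + 1)"
      using left_reflect[of n ?k] left_Suc_less[of n "2 ^ n - 1 - ?k"] idx_bounds[of n x]
      by linarith
    then have 2: "idx n (\<alpha> - x) \<le> 2 ^ n - ?k"
      by (simp flip: idx_less_iff)
    have "1 - (?k + 2) / 2 ^ n = real_of_int (2 ^ n - 2 - ?k) / 2 ^ n"
      "1 - ?k / 2 ^ n = real_of_int (2 ^ n - ?k) / 2 ^ n"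
      by (simp_all add: diff_divide_distrib add_divide_distrib)
    with 1 2 show "1 - (?k + 2) / 2 ^ n \<le> idx n (\<alpha> - x) / 2 ^ n"
      "idx n (\<alpha> - x) / 2 ^ n \<le> 1 - ?k / 2 ^ n"
      by (simp_all only: divide_right_mono of_int_le_iff zero_le_power zero_le_numeral)
  qed
  have "(\<lambda>n. 1 - (idx n x / 2 ^ n + 2 / 2 ^ n)) \<longlonglongrightarrow> 1 - (Phi x + 0)"
    by (intro tendsto_diff tendsto_add idx_scaled_tendsto const_scaled_tendsto_0 tendsto_const)
  then have 1: "(\<lambda>n. 1 - (idx n x + 2) / 2 ^ n) \<longlonglongrightarrow> 1 - Phi x"
    by (simp add: add_divide_distrib)
  have 2: "(\<lambda>n. 1 - idx n x / 2 ^ n) \<longlonglongrightarrow> 1 - Phi x"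
    by (intro tendsto_diff idx_scaled_tendsto tendsto_const)
  have "(\<lambda>n. idx n (\<alpha> - x) / 2 ^ n) \<longlonglongrightarrow> 1 - Phi x"
    by (rule tendsto_sandwich[OF _ _ 1 2]) (use bd in simp_all)
  then show ?thesis
    using idx_scaled_tendsto LIMSEQ_unique by blast
qed

lemma Phi_right: "Phi (left n k + len n) = (k + 1) / 2 ^ n"
proof -
  have "left n k + len n = \<alpha> - left n (2 ^ n - 1 - k)"
    using left_reflect[of n k] by simp
  then have "Phi (left n k + len n) = 1 - (2 ^ n - 1 - k) / 2 ^ n"
    by (simp add: Phi_reflect Phi_left)
  then show ?thesis by (simp add: field_simps)
qed

lemma Phi_gap:
  assumes "left n k + len n \<le> x" "x \<le> left n (k + 1)"
  shows "Phi x = (k + 1) / 2 ^ n"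
  using Phi_mono[OF assms(1)] Phi_mono[OF assms(2)] by (simp add: Phi_right Phi_left)

lemma Phi_gap_0: "\<alpha> - 1 \<le> x \<Longrightarrow> x \<le> 0 \<Longrightarrow> Phi x = 0"
  using Phi_gap[of 0 "-1" x] by simp

lemma Phi_of_nat_mult: "Phi (of_nat m * x) \<le> of_nat m * Phi x"
proof (induction m)
  case (Suc m)
  then show ?case using Phi_subadd[of x "of_nat m * x"] by (simp add: algebra_simps)
qed simp

text \<open>If \<open>Phi x < x\<close>, subadditivity pushes \<open>Phi (m * x)\<close> more than 1
  below \<open>m * x\<close> for large \<open>m\<close>, whereas \<open>Phi\<close> is never below
  the floor function.\<close>

lemma Phi_ge: "x \<le> Phi x"
proof (rule ccontr)
  assume "\<not> x \<le> Phi x"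
  then obtain m where m: "1 < real m * (x - Phi x)"
    using reals_Archimedean3[of "x - Phi x"] by auto
  have "of_int \<lfloor>y\<rfloor> \<le> Phi y" for y
    using Phi_mono[of "of_int \<lfloor>y\<rfloor>" y] Phi_left[of 0 "\<lfloor>y\<rfloor>"] by simp
  then have "of_int \<lfloor>m * x\<rfloor> \<le> m * Phi x"
    using Phi_of_nat_mult[of m x] order_trans by blast
  then show False
    using m by (simp add: algebra_simps) linarith
qed

section \<open>The periodic extension of \<psi>\<close>

definition psi_per :: "real \<Rightarrow> real" where
  "psi_per x = (Phi x - x) / (1 - \<alpha>)"

lemma psi_per_0: "psi_per 0 = 0"
  by (simp add: psi_per_def)

lemma psi_per_nonneg: "0 \<le> psi_per x"
  using Phi_ge[of x] alpha_less_1 by (simp add: psi_per_def)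

lemma psi_per_subadd: "psi_per (x + y) \<le> psi_per x + psi_per y"
proof -
  have "(Phi (x + y) - (x + y)) / (1 - \<alpha>) \<le> ((Phi x - x) + (Phi y - y)) / (1 - \<alpha>)"
    using Phi_subadd[of x y] alpha_less_1 by (intro divide_right_mono) auto
  then show ?thesis by (simp add: psi_per_def add_divide_distrib)
qed

lemma psi_per_reflect: "psi_per (\<alpha> - x) = 1 - psi_per x"
  using alpha_less_1 by (simp add: psi_per_def Phi_reflect field_simps)

lemma Phi_plus_int: "Phi (x + of_int k) = Phi x + of_int k"
proof (induction k rule: int_induct[where k = 0])
  case (step1 i)
  then show ?case using Phi_plus_1[of "x + of_int i"] by (simp add: algebra_simps)
next
  case (step2 i)
  then show ?case using Phi_plus_1[of "x + of_int (i - 1)"] by (simp add: algebra_simps)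
qed simp

lemma psi_per_frac: "psi_per (frac x) = psi_per x"
  using Phi_plus_int[of "frac x" "\<lfloor>x\<rfloor>"] by (simp add: psi_per_def frac_def)

section \<open>Identification of the stages\<close>

text \<open>Piecewise linear interpolation of \<open>Phi\<close> that rises by
  \<open>1 / 2 ^ n\<close> on each block; \<open>min 1\<close> freezes it on the gap that
  follows.\<close>

definition Phi_stage :: "nat \<Rightarrow> real \<Rightarrow> real" where
  "Phi_stage n x = (idx n x + min 1 ((x - left n (idx n x)) / len n)) / 2 ^ n"

definition psi_stage :: "nat \<Rightarrow> real \<Rightarrow> real" where
  "psi_stage n x = (Phi_stage n x - x) / (1 - \<alpha>)"

lemma Phi_stage_block:
  assumes "left n k \<le> x" "x \<le> left n k + len n"
  shows "Phi_stage n x = (k + (x - left n k) / len n) / 2 ^ n"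
proof -
  have "idx n x = k"
    using assms left_Suc_less[of n k] by (intro idx_unique) auto
  then show ?thesis
    using assms len_pos[of n] by (simp add: Phi_stage_def min_def)
qed

lemma Phi_stage_gap:
  assumes "left n k + len n \<le> x" "x \<le> left n (k + 1)"
  shows "Phi_stage n x = (k + 1) / 2 ^ n"
proof (cases "x = left n (k + 1)")
  case True
  then show ?thesis by (simp add: Phi_stage_def idx_left)
next
  case False
  have "idx n x = k"
    using assms False len_pos[of n] by (intro idx_unique) auto
  then show ?thesis
    using assms len_pos[of n] by (simp add: Phi_stage_def min_def field_simps)
qed

lemma psi_stage_tendsto: "(\<lambda>n. psi_stage n x) \<longlonglongrightarrow> psi_per x"
proof -
  have 1: "(\<lambda>n. idx n x / 2 ^ n + 1 / 2 ^ n) \<longlonglongrightarrow> Phi x"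
    using tendsto_add[OF idx_scaled_tendsto[of x] const_scaled_tendsto_0[of 1]] by simp
  have "0 \<le> (x - left n (idx n x)) / len n" for n
    using idx_bounds[of n x] len_pos[of n] by simp
  then have "idx n x / 2 ^ n \<le> Phi_stage n x" "Phi_stage n x \<le> idx n x / 2 ^ n + 1 / 2 ^ n" for n
    by (simp_all add: Phi_stage_def divide_right_mono flip: add_divide_distrib)
  then have "(\<lambda>n. Phi_stage n x) \<longlonglongrightarrow> Phi x"
    by (intro tendsto_sandwich[OF _ _ idx_scaled_tendsto 1]) auto
  then show ?thesis
    unfolding psi_stage_def psi_per_def using alpha_less_1 by (intro tendsto_intros) auto
qed

lemma block_subset:
  assumes "0 \<le> k" "k < 2 ^ n"
  shows "{left n k..left n k + len n} \<subseteq> {0..\<alpha>}"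
  using left_mono[of 0 k n] left_mono[of k "2 ^ n - 1" n] left_reflect[of n 0] assms by auto

lemma block_const_pos_slope:
  assumes eq: "\<And>x. x \<in> {0..\<alpha>} \<Longrightarrow> g x = psi_stage n x"
    and k: "0 \<le> k" "k < 2 ^ n"
  shows "const_pos_slope g (left n k) (left n k + len n)"
proof -
  \<comment> \<open>\<open>Phi_stage n\<close> has slope \<open>1 / (2 ^ n * len n)\<close> on a
    block. This exceeds 1 because the blocks of a period have total length at most \<alpha>.\<close>
  define m where "m = (1 / (2 ^ n * len n) - 1) / (1 - \<alpha>)"
  have "2 ^ n * len n < 1" "0 < 2 ^ n * len n"
    using len_scaled_le[of n] alpha_less_1 len_pos[of n] by auto
  then have "0 < m"
    using alpha_less_1 by (simp add: m_def)
  moreover have "g y - g x = m * (y - x)"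
    if "x \<in> {left n k..left n k + len n}" "y \<in> {left n k..left n k + len n}" for x y
  proof -
    have "g x = psi_stage n x" "g y = psi_stage n y"
      using that block_subset[OF k] by (auto intro!: eq)
    then show ?thesis
      using that len_pos[of n] alpha_less_1
      by (simp add: psi_stage_def Phi_stage_block[of n k] m_def field_simps)
  qed
  ultimately show ?thesis
    using len_pos[of n] unfolding const_pos_slope_def by (intro conjI exI[of _ m]) auto
qed

text \<open>An interval reaching beyond its block would contain two points of the following gap,
  where the function strictly decreases.\<close>

lemma const_pos_slope_in_block:
  assumes eq: "\<And>x. x \<in> {0..\<alpha>} \<Longrightarrow> g x = psi_stage n x"
    and sub: "{a..b} \<subseteq> {0..\<alpha>}" and slope: "const_pos_slope g a b"
  obtains k where "0 \<le> k" "k < 2 ^ n" "left n k \<le> a" "b \<le> left n k + len n"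
proof
  let ?k = "idx n a"
  from slope have "a < b"
    by (simp add: const_pos_slope_def)
  with sub have ab: "0 \<le> a" "b \<le> \<alpha>" by auto
  show "left n ?k \<le> a" using idx_bounds[of n a] by simp
  show "0 \<le> ?k" using idx_mono[OF ab(1), of n] idx_left[of n 0] by simp
  show "?k < 2 ^ n"
    using left_period[of n 0] ab \<open>a < b\<close> alpha_less_1 by (simp add: idx_less_iff)
  show "b \<le> left n ?k + len n"
  proof (rule ccontr)
    assume *: "\<not> b \<le> left n ?k + len n"
    define x where "x = max a (left n ?k + len n)"
    have x: "left n ?k + len n \<le> x" "x < left n (?k + 1)" "a \<le> x" "x < b"
      using left_Suc_less[of n ?k] idx_bounds[of n a] * \<open>a < b\<close> by (auto simp: x_def)
    obtain y where y: "x < y" "y < min b (left n (?k + 1))"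
      using dense[of x "min b (left n (?k + 1))"] x by auto
    have "psi_stage n y < psi_stage n x"
      using x y alpha_less_1
      by (simp add: psi_stage_def Phi_stage_gap[of n ?k] divide_strict_right_mono)
    moreover have "g x = psi_stage n x" "g y = psi_stage n y"
      using x y ab by (auto intro!: eq)
    moreover obtain m where "0 < m" "g y - g x = m * (y - x)"
      using slope x y unfolding const_pos_slope_def by auto
    moreover have "0 < m * (y - x)"
      using \<open>0 < m\<close> y by simp
    ultimately show False by simp
  qed
qed

text \<open>Intervals of positive slope lie in blocks, blocks have positive slope, and distinct
  blocks are disjoint.\<close>

lemma max_pos_interval_iff:
  assumes eq: "\<And>x. x \<in> {0..\<alpha>} \<Longrightarrow> g x = psi_stage n x"
  shows "max_pos_interval \<alpha> g a b \<longleftrightarrow>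
    (\<exists>k. 0 \<le> k \<and> k < 2 ^ n \<and> a = left n k \<and> b = left n k + len n)"
proof
  assume max: "max_pos_interval \<alpha> g a b"
  then have sub: "{a..b} \<subseteq> {0..\<alpha>}" and slope: "const_pos_slope g a b"
    by (simp_all add: max_pos_interval_def)
  then obtain k where k: "0 \<le> k" "k < 2 ^ n" "left n k \<le> a" "b \<le> left n k + len n"
    using const_pos_slope_in_block[OF eq] by blast
  then have "{a..b} \<subseteq> {left n k..left n k + len n}" by simp
  then have "{left n k..left n k + len n} = {a..b}"
    using max block_subset[OF k(1,2)] block_const_pos_slope[OF eq k(1,2)]
    unfolding max_pos_interval_def by blast
  then have "a = left n k \<and> b = left n k + len n"
    using len_pos[of n] by (auto simp: Icc_eq_Icc)
  with k show "\<exists>k. 0 \<le> k \<and> k < 2 ^ n \<and> a = left n k \<and> b = left n k + len n" by blast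
next
  assume "\<exists>k. 0 \<le> k \<and> k < 2 ^ n \<and> a = left n k \<and> b = left n k + len n"
  then obtain k where k: "0 \<le> k" "k < 2 ^ n" and ab: "a = left n k" "b = left n k + len n"
    by blast
  have "{a'..b'} = {a..b}"
    if outer: "{a'..b'} \<subseteq> {0..\<alpha>}" "const_pos_slope g a' b'" "{a..b} \<subseteq> {a'..b'}" for a' b'
  proof -
    obtain j where j: "left n j \<le> a'" "b' \<le> left n j + len n"
      using const_pos_slope_in_block[OF eq outer(1,2)] by blast
    have sub: "a' \<le> a" "b \<le> b'"
      using outer(3) len_pos[of n] by (auto simp: ab)
    have "idx n a = j"
      using j sub left_Suc_less[of n j] len_pos[of n] by (intro idx_unique) (auto simp: ab)
    then have "j = k"
      by (simp add: ab idx_left)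
    with j sub show ?thesis by (auto simp: ab)
  qed
  then show "max_pos_interval \<alpha> g a b"
    using block_subset[OF k] block_const_pos_slope[OF eq k]
    unfolding max_pos_interval_def ab by blast
qed

text \<open>The outer segments are the graph over the new blocks \<open>2 * k\<close> and
  \<open>2 * k + 1\<close>, the middle one over the new gap between them.\<close>

lemma three_segments_eq:
  assumes eq: "\<And>x. x \<in> {left n k..left n k + len n} \<Longrightarrow> g x = psi_stage n x"
    and x: "left n k \<le> x" "x \<le> left n k + len n"
  shows "three_segments \<alpha> (\<epsilon> (Suc n)) g (left n k) (left n k + len n) x = psi_stage (Suc n) x"
proof -
  let ?a = "left n k" and ?c = "len (Suc n)" and ?e = "\<epsilon> (Suc n)"
  have L: "len n = 2 * ?c + ?e" by (rule len_Suc_double)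
  have pos: "0 < ?c" "0 < ?e" "0 < len n" "0 < 1 - \<alpha>"
    using len_pos eps_pos alpha_less_1 by auto
  have mids: "(?a + (?a + len n) - ?e) / 2 = ?a + ?c" "(?a + (?a + len n) + ?e) / 2 = ?a + ?c + ?e"
    "(?a + (?a + len n)) / 2 = ?a + len n / 2"
    by (simp_all add: L)
  have "g ?a = (k / 2 ^ n - ?a) / (1 - \<alpha>)"
    "g (?a + len n / 2) = ((k + 1 / 2) / 2 ^ n - (?a + len n / 2)) / (1 - \<alpha>)"
    "g (?a + len n) = ((k + 1) / 2 ^ n - (?a + len n)) / (1 - \<alpha>)"
    using pos by (simp_all add: eq psi_stage_def Phi_stage_block[of n k])
  moreover have "k / 2 ^ n = 2 * k / 2 ^ Suc n" "(k + 1 / 2) / 2 ^ n = (2 * k + 1) / 2 ^ Suc n"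
    "(k + 1) / 2 ^ n = (2 * k + 2) / 2 ^ Suc n"
    by (simp_all add: field_simps)
  ultimately have vals: "g ?a = (2 * k / 2 ^ Suc n - ?a) / (1 - \<alpha>)"
    "g (?a + len n / 2) = ((2 * k + 1) / 2 ^ Suc n - (?a + len n / 2)) / (1 - \<alpha>)"
    "g (?a + len n) = ((2 * k + 2) / 2 ^ Suc n - (?a + len n)) / (1 - \<alpha>)"
    by (simp_all only:)
  have half: "?e / (2 * (1 - \<alpha>)) = ?e / 2 / (1 - \<alpha>)"
    by (simp only: divide_divide_eq_left)
  \<comment> \<open>The gap has slope \<open>- 1 / (1 - \<alpha>)\<close>, so moving by
    \<open>\<epsilon> (Suc n) / 2\<close> from the midpoint costs exactly the prescribed vertical
    offset.\<close>
  have shift: "(u - (?a + len n / 2)) / (1 - \<alpha>) + ?e / (2 * (1 - \<alpha>)) = (u - (?a + ?c)) / (1 - \<alpha>)"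
    "(u - (?a + len n / 2)) / (1 - \<alpha>) - ?e / (2 * (1 - \<alpha>)) = (u - (?a + ?c + ?e)) / (1 - \<alpha>)" for u
    unfolding half add_divide_distrib[symmetric] diff_divide_distrib[symmetric]
    by (intro arg_cong2[where f = "(/)"] refl; simp add: L field_simps)+
  note g = vals(1,3) shift[of "(2 * k + 1) / 2 ^ Suc n", folded vals(2)]
  have l: "left (Suc n) (2 * k) = ?a" "left (Suc n) (2 * k + 1) = ?a + ?c + ?e"
    by (simp_all only: left_even left_odd)
  \<comment> \<open>\<open>F j\<close> is the line that carries \<open>psi_stage (Suc n)\<close> on
    block \<open>j\<close>; \<open>G\<close> below is the one for the new gap.\<close>
  define F where "F j y = ((j + (y - left (Suc n) j) / ?c) / 2 ^ Suc n - y) / (1 - \<alpha>)" for j y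
  have F: "F j y = (1 / (?c * 2 ^ Suc n) - 1) / (1 - \<alpha>) * y
      + (j - left (Suc n) j / ?c) / 2 ^ Suc n / (1 - \<alpha>)" for j y
    by (simp add: F_def add_divide_distrib diff_divide_distrib left_diff_distrib)
  define G where "G y = ((2 * k + 1) / 2 ^ Suc n - y) / (1 - \<alpha>)" for y
  have G: "G y = (- 1 / (1 - \<alpha>)) * y + (2 * k + 1) / 2 ^ Suc n / (1 - \<alpha>)" for y
    by (simp add: G_def add_divide_distrib diff_divide_distrib)
  have segments: "three_segments \<alpha> ?e g ?a (?a + len n) x =
      (if x \<le> ?a + ?c
       then line_through (?a, g ?a) (?a + ?c, g (?a + len n / 2) + ?e / (2 * (1 - \<alpha>))) x
       else if x \<le> ?a + ?c + ?e
       then line_through (?a + ?c, g (?a + len n / 2) + ?e / (2 * (1 - \<alpha>)))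
              (?a + ?c + ?e, g (?a + len n / 2) - ?e / (2 * (1 - \<alpha>))) x
       else line_through (?a + ?c + ?e, g (?a + len n / 2) - ?e / (2 * (1 - \<alpha>)))
              (?a + len n, g (?a + len n)) x)"
    by (simp only: three_segments_def Let_def mids fst_conv snd_conv)
  consider "x \<le> ?a + ?c" | "?a + ?c < x" "x \<le> ?a + ?c + ?e" | "?a + ?c + ?e < x" by linarith
  then show ?thesis
  proof cases
    case 1
    have "F (2 * k) ?a = (2 * k / 2 ^ Suc n - ?a) / (1 - \<alpha>)"
      "F (2 * k) (?a + ?c) = ((2 * k + 1) / 2 ^ Suc n - (?a + ?c)) / (1 - \<alpha>)"
      using pos by (simp_all add: F_def l)
    then have "g ?a = F (2 * k) ?a" "g (?a + len n / 2) + ?e / (2 * (1 - \<alpha>)) = F (2 * k) (?a + ?c)"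
      by (simp_all only: g)
    then have "three_segments \<alpha> ?e g ?a (?a + len n) x = F (2 * k) x"
      using 1 line_through_affine[OF _ F, of ?a "?a + ?c"] pos by (simp only: segments) simp
    then show ?thesis
      using 1 x by (simp add: psi_stage_def Phi_stage_block[of "Suc n" "2 * k"] l F_def)
  next
    case 2
    have "g (?a + len n / 2) + ?e / (2 * (1 - \<alpha>)) = G (?a + ?c)"
      "g (?a + len n / 2) - ?e / (2 * (1 - \<alpha>)) = G (?a + ?c + ?e)"
      by (simp_all only: g G_def)
    then have "three_segments \<alpha> ?e g ?a (?a + len n) x = G x"
      using 2 line_through_affine[OF _ G, of "?a + ?c" "?a + ?c + ?e"] pos by (simp only: segments) simp
    then show ?thesis
      using 2 by (simp add: psi_stage_def Phi_stage_gap[of "Suc n" "2 * k"] l G_def)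
  next
    case 3
    have "F (2 * k + 1) (?a + ?c + ?e) = ((2 * k + 1) / 2 ^ Suc n - (?a + ?c + ?e)) / (1 - \<alpha>)"
      "F (2 * k + 1) (?a + len n) = ((2 * k + 2) / 2 ^ Suc n - (?a + len n)) / (1 - \<alpha>)"
      using pos by (simp_all add: F_def l L)
    then have "g (?a + len n / 2) - ?e / (2 * (1 - \<alpha>)) = F (2 * k + 1) (?a + ?c + ?e)"
      "g (?a + len n) = F (2 * k + 1) (?a + len n)"
      by (simp_all only: g)
    moreover have "?a + ?c + ?e \<noteq> ?a + len n"
      using pos L by simp
    ultimately have "three_segments \<alpha> ?e g ?a (?a + len n) x = F (2 * k + 1) x"
      using 3 line_through_affine[OF _ F, of "?a + ?c + ?e" "?a + len n"] pos
      by (simp only: segments) simp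
    then show ?thesis
      using 3 x by (simp add: psi_stage_def Phi_stage_block[of "Suc n" "2 * k + 1"] l L F_def)
  qed
qed

lemma psi_seq_eq: "0 \<le> x \<Longrightarrow> x < 1 \<Longrightarrow> psi_seq \<alpha> \<epsilon> n x = psi_stage n x"
proof (induction n arbitrary: x)
  case 0
  then have "\<lfloor>x\<rfloor> = 0" by linarith
  then show ?case
    using alpha_pos alpha_less_1
    by (auto simp: psi_stage_def Phi_stage_def min_def field_simps)
next
  case (Suc n)
  let ?g = "psi_seq \<alpha> \<epsilon> n"
  have eq: "?g y = psi_stage n y" if "y \<in> {0..\<alpha>}" for y
    using Suc.IH that alpha_less_1 by simp
  let ?P = "\<lambda>(a, b). max_pos_interval \<alpha> ?g a b \<and> x \<in> {a..b}"
  let ?k = "idx n x"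
  have k: "0 \<le> ?k" "?k < 2 ^ n"
    using Suc.prems idx_mono[of 0 x n] idx_left[of n 0] left_period[of n 0]
    by (simp_all add: idx_less_iff)
  \<comment> \<open>Blocks of one stage are disjoint, so at most one pair qualifies and the choice
    in \<open>psi_step\<close> is determined.\<close>
  have P_iff: "?P ab \<longleftrightarrow> ab = (left n ?k, left n ?k + len n) \<and> x \<le> left n ?k + len n" for ab
  proof -
    obtain a b where ab: "ab = (a, b)" by (cases ab)
    have "?P ab \<longleftrightarrow>
        (\<exists>k. 0 \<le> k \<and> k < 2 ^ n \<and> a = left n k \<and> b = left n k + len n) \<and> x \<in> {a..b}"
      unfolding ab by (simp only: prod.case max_pos_interval_iff[OF eq])
    also have "\<dots> \<longleftrightarrow> ab = (left n ?k, left n ?k + len n) \<and> x \<le> left n ?k + len n"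
    proof -
      have "j = ?k" if "left n j \<le> x" "x \<le> left n j + len n" for j
        using that left_Suc_less[of n j] idx_unique[of n j x] by simp
      then show ?thesis
        using k idx_bounds[of n x] unfolding ab prod.inject atLeastAtMost_iff by metis
    qed
    finally show ?thesis .
  qed
  show ?case
  proof (cases "x \<le> left n ?k + len n")
    case True
    then have "(SOME ab. ?P ab) = (left n ?k, left n ?k + len n)"
      by (intro some_equality; simp only: P_iff)
    moreover have "\<exists>a b. max_pos_interval \<alpha> ?g a b \<and> x \<in> {a..b}"
      using True P_iff[of "(left n ?k, left n ?k + len n)"] by blast
    ultimately have "psi_seq \<alpha> \<epsilon> (Suc n) x =
        three_segments \<alpha> (\<epsilon> (Suc n)) ?g (left n ?k) (left n ?k + len n) x"
      by (simp only: psi_seq.simps psi_step_def if_True prod.case)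
    also have "\<dots> = psi_stage (Suc n) x"
      using True idx_bounds[of n x] block_subset[OF k] by (intro three_segments_eq eq) auto
    finally show ?thesis .
  next
    case False
    then have "\<nexists>a b. max_pos_interval \<alpha> ?g a b \<and> x \<in> {a..b}"
      using P_iff by blast
    then have "psi_seq \<alpha> \<epsilon> (Suc n) x = psi_stage n x"
      using Suc.IH[OF Suc.prems] by (simp only: psi_seq.simps psi_step_def if_False)
    \<comment> \<open>Old gaps survive refinement: \<open>x\<close> now lies in the gap after block
      \<open>2 * ?k + 1\<close>, with the same value of \<open>Phi_stage\<close>.\<close>
    also have "\<dots> = psi_stage (Suc n) x"
    proof -
      have "left (Suc n) (2 * ?k + 1) + len (Suc n) = left n ?k + len n"
        "left (Suc n) (2 * ?k + 1 + 1) = left n (?k + 1)"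
        using left_odd[of n ?k] left_even[of n "?k + 1"] len_Suc_double[of n]
        by (simp_all add: algebra_simps)
      then have "Phi_stage (Suc n) x = (2 * ?k + 2) / 2 ^ Suc n"
        using False idx_bounds[of n x] Phi_stage_gap[of "Suc n" "2 * ?k + 1" x] by simp
      moreover have "\<dots> = (?k + 1) / 2 ^ n"
        by (simp add: field_simps)
      ultimately show ?thesis
        using False idx_bounds[of n x] Phi_stage_gap[of n ?k x] by (simp add: psi_stage_def)
    qed
    finally show ?thesis .
  qed
qed

lemma psi_limit_eq:
  assumes "x \<in> {0..<1}"
  shows "psi_limit \<alpha> \<epsilon> x = psi_per x"
proof -
  have "(\<lambda>n. psi_seq \<alpha> \<epsilon> n x) = (\<lambda>n. psi_stage n x)"
    using assms by (auto intro: psi_seq_eq)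
  then show ?thesis
    unfolding psi_limit_def using psi_stage_tendsto limI by metis
qed

section \<open>Validity and the facet property\<close>

lemma weight_psi_limit:
  assumes "{r. s r \<noteq> 0} \<subseteq> {0..<1}"
  shows "weight (psi_limit \<alpha> \<epsilon>) s = weight psi_per s"
  unfolding weight_def using assms by (intro sum.cong) (auto simp: psi_limit_eq)

lemma valid_psi_limit: "valid_function \<alpha> (psi_limit \<alpha> \<epsilon>)"
proof -
  have "1 \<le> weight (psi_limit \<alpha> \<epsilon>) s" if "is_solution \<alpha> s" for s
    \<comment> \<open>Reflection at 0 provides the value 1 at \<alpha>.\<close>
    using subadditive_le_weight[OF psi_per_subadd psi_per_0 psi_per_frac that]
      psi_per_reflect[of 0] that
    by (simp add: psi_per_0 weight_psi_limit is_solution_def)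
  then show ?thesis
    by (simp add: valid_function_def psi_limit_eq psi_per_nonneg psi_per_0)
qed

section \<open>Functions tight wherever \<psi> is\<close>

context
  fixes \<pi>
  assumes valid: "valid_function \<alpha> \<pi>"
    and tight: "tight_solutions \<alpha> (psi_limit \<alpha> \<epsilon>) \<subseteq> tight_solutions \<alpha> \<pi>"
begin

definition per :: "real \<Rightarrow> real" where
  "per x = \<pi> (frac x)"

lemma per_0: "per 0 = 0"
  using valid by (simp add: per_def valid_function_def)

lemma per_nonneg: "0 \<le> per x"
  using valid by (simp add: per_def valid_function_def frac_lt_1)

lemma per_triple: "1 \<le> per u + per v + per (\<alpha> - u - v)"
  using valid triple_solution[of \<alpha> u v] alpha_pos alpha_less_1
  unfolding per_def valid_function_def by (metis weight_triple less_imp_le)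

lemma per_triple_eq:
  assumes "psi_per u + psi_per v + psi_per (\<alpha> - u - v) = 1"
  shows "per u + per v + per (\<alpha> - u - v) = 1"
proof -
  let ?s = "triple (frac u) (frac v) (frac (\<alpha> - u - v))"
  have sol: "is_solution \<alpha> ?s"
    using triple_solution alpha_pos alpha_less_1 by simp
  then have "weight (psi_limit \<alpha> \<epsilon>) ?s = weight psi_per ?s"
    by (intro weight_psi_limit) (simp add: is_solution_def)
  then have "?s \<in> tight_solutions \<alpha> (psi_limit \<alpha> \<epsilon>)"
    using sol assms by (simp add: tight_solutions_def weight_triple psi_per_frac)
  then have "?s \<in> tight_solutions \<alpha> \<pi>"
    using tight by blast
  then show ?thesis
    by (simp add: tight_solutions_def weight_triple per_def)
qed

text \<open>The entries \<open>u\<close>, 0 and \<open>\<alpha> - u\<close> form a tight solution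
  for \<psi> because \<psi> is symmetric.\<close>

lemma per_reflect: "per (\<alpha> - u) = 1 - per u"
  using per_triple_eq[of u 0] by (simp add: per_0 psi_per_0 psi_per_reflect)

text \<open>Validity on the triple of \<open>u\<close>, \<open>v\<close> and
  \<open>\<alpha> - u - v\<close>, with the third value rewritten by symmetry.\<close>

lemma per_subadd: "per (u + v) \<le> per u + per v"
  using per_triple[of u v] per_reflect[of "u + v"] by (simp add: algebra_simps)

lemma per_additive:
  assumes "psi_per (u + v) = psi_per u + psi_per v"
  shows "per (u + v) = per u + per v"
  using per_triple_eq[of u v] per_reflect[of "u + v"] psi_per_reflect[of "u + v"] assms
  by (simp add: algebra_simps)

text \<open>The inverse of the passage from \<open>Phi\<close> to \<open>psi_per\<close>; the aim is
  to show that it recovers \<open>Phi\<close>.\<close>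

definition g :: "real \<Rightarrow> real" where
  "g x = (1 - \<alpha>) * per x + x"

lemma g_0: "g 0 = 0"
  by (simp add: g_def per_0)

lemma g_plus_1: "g (x + 1) = g x + 1"
  by (simp add: g_def per_def frac_1_eq)

lemma g_subadd: "g (u + v) \<le> g u + g v"
  using mult_left_mono[OF per_subadd[of u v], of "1 - \<alpha>"] alpha_less_1
  by (simp add: g_def algebra_simps)

lemma g_additive:
  assumes "Phi (u + v) = Phi u + Phi v"
  shows "g (u + v) = g u + g v"
proof -
  have "psi_per (u + v) = psi_per u + psi_per v"
    using assms by (simp add: psi_per_def diff_divide_distrib add_divide_distrib)
  then show ?thesis
    using per_additive[of u v] by (simp add: g_def algebra_simps)
qed

text \<open>\<open>Phi\<close> vanishes on \<open>[\<alpha> - 1, 0]\<close>, so \<open>g\<close> is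
  additive there and doubling the argument halves the bound. Arguments in the far half are moved to
  the near half using that \<open>g\<close> vanishes at \<open>\<alpha> - 1\<close>.\<close>

lemma g_gap_bound:
  assumes "0 \<le> t" "t \<le> 1 - \<alpha>"
  shows "\<bar>g (- t)\<bar> \<le> 1 / 2 ^ n"
  using assms
proof (induction n arbitrary: t)
  case 0
  \<comment> \<open>Nonnegativity and symmetry confine \<open>per\<close> to \<open>[0, 1]\<close>,
    which gives the initial bound.\<close>
  have "per (- t) \<le> 1"
    using per_reflect[of "- t"] per_nonneg[of "\<alpha> - (- t)"] by simp
  then have "0 \<le> (1 - \<alpha>) * per (- t)" "(1 - \<alpha>) * per (- t) \<le> 1 - \<alpha>"
    using per_nonneg[of "- t"] alpha_less_1 by (simp_all add: mult_left_le)
  then show ?case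
    using 0 alpha_pos unfolding g_def by simp
next
  case (Suc n)
  have add: "g (- s) + g (- t) = g (- (s + t))" if "0 \<le> s" "0 \<le> t" "s + t \<le> 1 - \<alpha>" for s t
    using g_additive[of "- s" "- t"] that by (simp add: Phi_gap_0)
  have half: "\<bar>g (- s)\<bar> \<le> 1 / 2 ^ Suc n" if "0 \<le> s" "s \<le> (1 - \<alpha>) / 2" for s
    using Suc.IH[of "s + s"] add[of s s] that by simp
  have "g \<alpha> = 1"
    using per_reflect[of 0] by (simp add: g_def per_0)
  then have "g (- (1 - \<alpha>)) = 0"
    using g_plus_1[of "- (1 - \<alpha>)"] by simp
  then have "g (- t) + g (- (1 - \<alpha> - t)) = 0"
    using add[of t "1 - \<alpha> - t"] Suc.prems by simp
  then show ?case
    using half[of t] half[of "1 - \<alpha> - t"] Suc.prems by (cases "t \<le> (1 - \<alpha>) / 2") auto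
qed

lemma g_gap_0:
  assumes "0 \<le> t" "t \<le> 1 - \<alpha>"
  shows "g (- t) = 0"
  using LIMSEQ_le_const[OF const_scaled_tendsto_0[of 1], of "\<bar>g (- t)\<bar>"] g_gap_bound[OF assms]
  by auto

text \<open>A step back by at most \<open>1 - \<alpha>\<close> cannot increase \<open>g\<close>, by
  subadditivity and \<open>g_gap_0\<close>; a longer distance is cut into \<open>m\<close> such
  steps.\<close>

lemma g_mono:
  assumes "x \<le> y"
  shows "g x \<le> g y"
proof -
  obtain m where m: "(y - x) / (1 - \<alpha>) < real m"
    using reals_Archimedean2 by blast
  then have "0 < real m"
    using assms alpha_less_1 by (smt (verit) divide_nonneg_pos)
  define s where "s = (y - x) / real m"
  have s: "0 \<le> s" "s \<le> 1 - \<alpha>" "x = y - real m * s"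
    using m \<open>0 < real m\<close> assms alpha_less_1
    by (simp_all add: s_def pos_divide_less_eq pos_divide_le_eq mult.commute)
  have "g (y - real j * s) \<le> g y" for j
  proof (induction j)
    case (Suc j)
    then show ?case
      using g_subadd[of "y - real j * s" "- s"] g_gap_0[of s] s by (simp add: algebra_simps)
  qed simp
  then show ?thesis by (simp only: s(3))
qed

text \<open>\<open>Phi\<close> is additive both when a block is appended to its left endpoint and
  when the gap is crossed backwards, where the shift \<open>- ?t\<close> contributes 0.\<close>

lemma g_left_step: "g (left n (k + 1)) = g (left n k) + g (len n)"
proof -
  let ?t = "left n (k + 1) - (left n k + len n)"
  have t: "0 \<le> ?t" "?t \<le> 1 - \<alpha>"
    using left_Suc_less[of n k] left_step_le[of n k] by simp_all
  have "g (left n (k + 1) + - ?t) = g (left n (k + 1)) + g (- ?t)"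
    using t by (intro g_additive) (simp add: Phi_gap_0 Phi_right Phi_left)
  moreover have "g (left n k + len n) = g (left n k) + g (len n)"
    using Phi_right[of n 0] by (intro g_additive) (simp add: Phi_right Phi_left add_divide_distrib)
  ultimately show ?thesis
    using g_gap_0[OF t] by simp
qed

text \<open>The \<open>2 ^ n\<close> equal increments of one period add up to
  \<open>g 1 = 1\<close>.\<close>

lemma g_left:
  assumes "0 \<le> k"
  shows "g (left n k) = k / 2 ^ n"
proof -
  have mult: "g (left n (int m)) = m * g (len n)" for m
  proof (induction m)
    case (Suc m)
    then show ?case
      using g_left_step[of n "int m"] by (simp add: algebra_simps)
  qed (simp add: g_0)
  have "g 1 = 1"
    using g_plus_1[of 0] by (simp add: g_0)
  then have "g (len n) = 1 / 2 ^ n"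
    using mult[of "2 ^ n"] left_period[of n 0] by (simp add: field_simps)
  then show ?thesis
    using mult[of "nat k"] assms by simp
qed

text \<open>Monotonicity traps \<open>g x\<close> between its values at two consecutive left
  endpoints, which differ by \<open>1 / 2 ^ n\<close>.\<close>

lemma g_eq_Phi:
  assumes "0 \<le> x"
  shows "g x = Phi x"
proof -
  have nonneg: "0 \<le> idx n x" for n
    using idx_mono[OF assms, of n] idx_left[of n 0] by simp
  have lower: "idx n x / 2 ^ n \<le> g x" for n
    using g_mono[of "left n (idx n x)" x] idx_bounds[of n x] g_left[OF nonneg[of n], of n] by simp
  have upper: "g x \<le> idx n x / 2 ^ n + 1 / 2 ^ n" for n
    using g_mono[of x "left n (idx n x + 1)"] idx_bounds[of n x] g_left[of "idx n x + 1" n] nonneg[of n]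
    by (simp add: add_divide_distrib)
  have "Phi x \<le> g x"
    by (rule LIMSEQ_le_const2[OF idx_scaled_tendsto]) (use lower in auto)
  moreover have "g x \<le> Phi x + 0"
    by (rule LIMSEQ_le_const[OF tendsto_add[OF idx_scaled_tendsto const_scaled_tendsto_0]])
      (use upper in auto)
  ultimately show ?thesis by simp
qed

lemma eq_psi_limit:
  assumes "r \<in> {0..<1}"
  shows "\<pi> r = psi_limit \<alpha> \<epsilon> r"
proof -
  have "frac r = r"
    using assms by (simp add: frac_eq)
  then have "(1 - \<alpha>) * \<pi> r + r = Phi r"
    using g_eq_Phi[of r] assms by (simp add: g_def per_def)
  then show ?thesis
    using assms alpha_less_1 by (simp add: psi_limit_eq psi_per_def field_simps)
qed

end

end

theorem theorem5p7:
  fixes \<alpha> :: real and \<epsilon> :: "nat \<Rightarrow> real"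
  assumes "0 < \<alpha>" and "\<alpha> < 1"
    and "\<And>i. 1 \<le> i \<Longrightarrow> 0 < \<epsilon> i"
    and "\<And>i j. 1 \<le> i \<Longrightarrow> i \<le> j \<Longrightarrow> \<epsilon> j \<le> \<epsilon> i"
    and "\<epsilon> 1 \<le> 1 - \<alpha>"
    and "summable (\<lambda>i. 2 ^ i * \<epsilon> (Suc i))"
    and "(\<Sum>i. 2 ^ i * \<epsilon> (Suc i)) < \<alpha>"
  shows "is_facet \<alpha> (psi_limit \<alpha> \<epsilon>)"
proof -
  interpret construction \<alpha> \<epsilon>
    by unfold_locales (use assms in auto)
  show ?thesis
    unfolding is_facet_def using valid_psi_limit eq_psi_limit by blast
qed

end
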